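(* Let $0<a\leq1$ and $C\geq(2a)^{1/4}$ be fixed. If $\{e_n\}_{n=0}^N\subset L^2(\mathbb{R})$ is an orthonormal set such that for all $n$ and for almost every $x,\xi\in\mathbb{R}$, $$|e_n(x)|\leq Ce^{-\pi a|x|^2}\quad\text{and}\quad|\widehat{e}_n(\xi)|\leq Ce^{-\pi a|\xi|^2},$$ then $$N\leq2+\frac{8}{a\pi}\max\left\{2\ln\left(\frac{50C\sqrt{\pi}e^{\pi}}{a^{1/4}}\right),\ \ln\left(\frac{50\pi C^2e^{\pi a/2}}{a^{5/2}e^{2\pi}}\right)\right\}.$$
   Context: The Fourier transform is $\widehat{f}(\xi)=\int f(t)e^{-2i\pi t\xi}\,dt$ for $f\in L^1(\mathbb{R})$, extended to $L^2(\mathbb{R})$ as usual. *)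

theory Defs
  imports "HOL-Analysis.Analysis"
begin

text \<open>
  Elements of \<open>L\<^sup>2(\<real>)\<close> are represented by Borel functions \<open>\<real> \<Rightarrow> \<complex>\<close>; every almost-everywhere
  class has such a representative.
\<close>

definition square_integrable :: "(real \<Rightarrow> complex) \<Rightarrow> bool" where
  "square_integrable f \<longleftrightarrow>
     f \<in> borel_measurable lborel \<and> integrable lborel (\<lambda>x. (cmod (f x))\<^sup>2)"

definition L2_inner :: "(real \<Rightarrow> complex) \<Rightarrow> (real \<Rightarrow> complex) \<Rightarrow> complex" where
  "L2_inner f g = (LINT x|lborel. f x * cnj (g x))"

text \<open>
  The squared distance is taken in \<^typ>\<open>ennreal\<close>, so that convergence to \<open>0\<close> cannot hold merely
  because a Bochner integral of a non-integrable function is \<open>0\<close>.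
\<close>

definition L2_tendsto :: "(nat \<Rightarrow> real \<Rightarrow> complex) \<Rightarrow> (real \<Rightarrow> complex) \<Rightarrow> bool" where
  "L2_tendsto F f \<longleftrightarrow>
     (\<lambda>k. \<integral>\<^sup>+ x. ennreal ((cmod (F k x - f x))\<^sup>2) \<partial>lborel) \<longlonglongrightarrow> 0"

definition orthonormal_family :: "'i set \<Rightarrow> ('i \<Rightarrow> real \<Rightarrow> complex) \<Rightarrow> bool" where
  "orthonormal_family I e \<longleftrightarrow>
     (\<forall>n\<in>I. square_integrable (e n)) \<and>
     (\<forall>m\<in>I. \<forall>n\<in>I. L2_inner (e m) (e n) = (if m = n then 1 else 0))"

definition fourier :: "(real \<Rightarrow> complex) \<Rightarrow> real \<Rightarrow> complex" where
  "fourier f \<xi> = (LINT t|lborel. f t * exp (- 2 * \<i> * of_real pi * of_real t * of_real \<xi>))"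

text \<open>
  The continuous extension of the integral transform from \<open>L\<^sup>1 \<inter> L\<^sup>2\<close> to \<open>L\<^sup>2\<close>. Its graph is the
  closure in \<open>L\<^sup>2 \<times> L\<^sup>2\<close> of the graph of \<^const>\<open>fourier\<close> on \<open>L\<^sup>1 \<inter> L\<^sup>2\<close>. It is given as a relation
  because the transform of \<open>f\<close> is only determined up to a null set. By Plancherel's theorem every
  square-integrable \<open>f\<close> has such a \<open>g\<close>, unique almost everywhere.
\<close>

definition has_L2_fourier :: "(real \<Rightarrow> complex) \<Rightarrow> (real \<Rightarrow> complex) \<Rightarrow> bool" where
  "has_L2_fourier f g \<longleftrightarrow>
     square_integrable f \<and> square_integrable g \<and>
     (\<exists>F. (\<forall>k. integrable lborel (F k) \<and> square_integrable (F k)) \<and>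
          L2_tendsto F f \<and> L2_tendsto (\<lambda>k. fourier (F k)) g)"

lemma has_L2_fourier_integral:
  assumes "integrable lborel f" "square_integrable f" "square_integrable (fourier f)"
  shows "has_L2_fourier f (fourier f)"
  unfolding has_L2_fourier_def L2_tendsto_def
  using assms by (auto intro!: exI[of _ "\<lambda>_. f"])

end

theory Submission imports Defs "HOL-Probability.Probability" begin

text \<open>
  Write \<open>\<F>\<close> for the Fourier transform and let \<open>P\<close> and \<open>Q\<close> be the cut-offs to \<open>[-T, T]\<close> in time and
  in frequency. For a fixed frequency \<open>\<xi>\<close>, Bessel's inequality applied to the truncated wave
  \<open>exp (2 \<pi> i t \<xi>)\<close>, \<open>\<bar>t\<bar> \<le> T\<close>, whose squared norm is \<open>2T\<close>, bounds the sum over \<open>n\<close> of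
  \<open>\<bar>\<F>(P e\<^sub>n)(\<xi>)\<bar>\<^sup>2\<close>. Integrating over \<open>[-T, T]\<close>, the squared norms of \<open>Q \<F> P e\<^sub>n\<close> sum to at most
  \<open>4T\<^sup>2\<close>. On the other hand, the Gaussian bounds and Plancherel's theorem make each of them close to
  \<open>1\<close> as soon as \<open>a \<pi> T\<^sup>2\<close> is the first argument of the maximum. Hence \<open>N + 1 \<le> 8T\<^sup>2\<close>.

  Plancherel's theorem is only needed for functions with a Gaussian majorant. It comes from damping
  the frequency integral by a Gaussian, whose transform is an approximate identity.
\<close>

section \<open>The Fourier integral\<close>

lemma fourier_cis: "fourier f \<xi> = (LINT t|lborel. f t * cis (- (2 * pi * t * \<xi>)))"
  unfolding fourier_def cis_conv_exp by (simp add: mult_ac)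

lemma borel_measurable_cis [measurable]: "cis \<in> borel_measurable borel"
  by (intro borel_measurable_continuous_onI continuous_intros)

lemma borel_measurable_cnj [measurable]: "cnj \<in> borel_measurable borel"
  by (intro borel_measurable_continuous_onI continuous_intros)

lemma integrable_mult_bounded:
  fixes f g :: "'a \<Rightarrow> complex"
  assumes "integrable M f" "g \<in> borel_measurable M" "\<And>x. norm (g x) \<le> B"
  shows "integrable M (\<lambda>x. f x * g x)"
proof (rule Bochner_Integration.integrable_bound)
  show "integrable M (\<lambda>x. of_real B * f x)" using assms(1) by simp
  show "(\<lambda>x. f x * g x) \<in> borel_measurable M" using assms(1,2) by measurable
  have "norm (f x * g x) \<le> norm (of_real B * f x)" for x
    using mult_left_mono[OF order.trans[OF assms(3) abs_ge_self], of "norm (f x)" x]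
    by (simp add: norm_mult mult.commute)
  then show "AE x in M. norm (f x * g x) \<le> norm (of_real B * f x)" by simp
qed

lemma integrable_mult_pair:
  fixes f g :: "real \<Rightarrow> complex"
  assumes f: "integrable lborel f" and g: "integrable lborel g"
  shows "integrable (lborel \<Otimes>\<^sub>M lborel) (\<lambda>(x, y). f x * g y)"
proof (rule lborel_pair.Fubini_integrable)
  have [measurable]: "f \<in> borel_measurable borel" "g \<in> borel_measurable borel"
    using f g by auto
  show "(\<lambda>(x, y). f x * g y) \<in> borel_measurable (lborel \<Otimes>\<^sub>M lborel)" by measurable
qed (use f g in \<open>auto simp: norm_mult\<close>)

text \<open>Prepares both Fubini exchanges in \<open>fourier_weighted_norm\<close>: there
  \<open>h\<close> is a phase of modulus 1 that couples the two variables, while \<open>f\<close>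
  and \<open>g\<close> are integrable separately.\<close>

lemma integrable_mult_pair_bounded:
  fixes f g :: "real \<Rightarrow> complex" and h :: "real \<Rightarrow> real \<Rightarrow> complex"
  assumes "integrable lborel f" "integrable lborel g"
    and "case_prod h \<in> borel_measurable (lborel \<Otimes>\<^sub>M lborel)" "\<And>x y. norm (h x y) \<le> B"
  shows "integrable (lborel \<Otimes>\<^sub>M lborel) (\<lambda>(x, y). f x * g y * h x y)"
  using integrable_mult_bounded[OF integrable_mult_pair[OF assms(1,2)] assms(3), of B] assms(4)
  by (simp add: case_prod_unfold)

lemma borel_measurable_fourier [measurable]:
  assumes [measurable]: "f \<in> borel_measurable borel"
  shows "fourier f \<in> borel_measurable borel"
  unfolding fourier_cis by measurable

lemma norm_fourier_le:
  "norm (fourier f \<xi>) \<le> (LINT t|lborel. norm (f t))"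
  unfolding fourier_cis using integral_norm_bound[of lborel "\<lambda>t. f t * cis (- (2 * pi * t * \<xi>))"]
  by (simp add: norm_mult)

lemma integrable_mult_cis:
  assumes "integrable lborel f"
  shows "integrable lborel (\<lambda>t. f t * cis (- (2 * pi * t * \<xi>)))"
  by (rule integrable_mult_bounded[OF assms, of _ 1]) auto

lemma fourier_diff:
  assumes "integrable lborel f" "integrable lborel g"
  shows "fourier (\<lambda>t. f t - g t) \<xi> = fourier f \<xi> - fourier g \<xi>"
  unfolding fourier_cis using assms
  by (simp add: left_diff_distrib integrable_mult_cis)

section \<open>Gaussian summation and Plancherel\<close>

text \<open>The damping factor: at most 1, integrable for \<open>d > 0\<close>, and tending to 1 as
  \<open>d\<close> tends to 0. The exponent is scaled to match the standard normal density, so that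
  its characteristic function can be used.\<close>

definition gauss_weight :: "real \<Rightarrow> real \<Rightarrow> real" where
  "gauss_weight d \<xi> = exp (- (d * \<xi>)\<^sup>2 / 2)"

lemma borel_measurable_gauss_weight [measurable]: "gauss_weight d \<in> borel_measurable borel"
  unfolding gauss_weight_def by measurable

lemma gauss_weight_nonneg: "0 \<le> gauss_weight d \<xi>" and gauss_weight_le_1: "gauss_weight d \<xi> \<le> 1"
  by (simp_all add: gauss_weight_def)

lemma gauss_weight_eq: "gauss_weight d \<xi> = sqrt (2 * pi) * std_normal_density (d * \<xi>)"
  by (simp add: gauss_weight_def std_normal_density_def)

lemma integrable_gauss_weight:
  assumes "0 < d" shows "integrable lborel (gauss_weight d)"
proof -
  have "integrable lborel (\<lambda>\<xi>. std_normal_density (0 + d * \<xi>))"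
    using assms by (intro lborel_integrable_real_affine) auto
  then show ?thesis unfolding gauss_weight_eq[abs_def] by simp
qed

text \<open>Rescaling by \<open>d\<close> turns the integral into the characteristic function of the
  standard normal law, itself a Gaussian. The value is a probability density of standard deviation
  \<open>d / (2 * pi)\<close>, hence an approximate identity as \<open>d\<close> tends to 0.\<close>

lemma fourier_gauss_weight:
  assumes d: "0 < d"
  shows "(LINT \<xi>|lborel. of_real (gauss_weight d \<xi>) * cis (- (2 * pi * x * \<xi>)))
    = complex_of_real (normal_density 0 (d / (2 * pi)) x)"
proof -
  \<comment> \<open>Chosen so that \<open>t * (d * \<xi>)\<close> is the phase
    \<open>- (2 * pi * x * \<xi>)\<close>.\<close>
  define t where "t = - (2 * pi * x / d)"
  have "complex_of_real (exp (- t\<^sup>2 / 2)) = char std_normal_distribution t"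
    by (simp add: char_std_normal_distribution)
  also have "\<dots> = (LINT z|lborel. std_normal_density z *\<^sub>R cis (t * z))"
    unfolding char_def by (subst integral_density) (auto simp: cis_conv_exp)
  also have "\<dots> = d *\<^sub>R (LINT z|lborel. std_normal_density (d * z) *\<^sub>R cis (t * (d * z)))"
    by (subst lborel_integral_real_affine[where c=d and t=0]) (use d in auto)
  also have "\<dots> = (d / sqrt (2 * pi)) *\<^sub>R
      (LINT \<xi>|lborel. of_real (gauss_weight d \<xi>) * cis (- (2 * pi * x * \<xi>)))"
    unfolding gauss_weight_eq using d
    by (simp add: t_def scaleR_conv_of_real mult.assoc flip: integral_mult_right_zero)
  finally have "(LINT \<xi>|lborel. of_real (gauss_weight d \<xi>) * cis (- (2 * pi * x * \<xi>)))
     = of_real (sqrt (2 * pi) / d * exp (- t\<^sup>2 / 2))"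
    using d by (simp add: scaleR_conv_of_real field_simps)
  also have "sqrt (2 * pi) / d * exp (- t\<^sup>2 / 2) = normal_density 0 (d / (2 * pi)) x"
  proof -
    have "sqrt (2 * pi * (d / (2 * pi))\<^sup>2) = d / sqrt (2 * pi)"
    proof -
      have "2 * pi * (d / (2 * pi))\<^sup>2 = d\<^sup>2 / (2 * pi)"
        by (simp add: power2_eq_square)
      then show ?thesis using d by (simp add: real_sqrt_divide)
    qed
    moreover have "- t\<^sup>2 / 2 = - (x - 0)\<^sup>2 / (2 * (d / (2 * pi))\<^sup>2)"
      using d by (simp add: t_def field_simps power2_eq_square)
    ultimately show ?thesis unfolding normal_density_def by simp
  qed
  finally show ?thesis .
qed

text \<open>Expand both transforms and move the \<open>\<xi>\<close>-integral inside: there it meets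
  only the weight and the phase of \<open>s - t\<close>, which produces the Gaussian kernel. The
  weight makes the exchanges absolutely convergent, since \<open>fourier f\<close> is only known to
  be bounded.\<close>

lemma fourier_weighted_norm:
  assumes f: "integrable lborel f" and d: "0 < d"
  shows "(LINT \<xi>|lborel. of_real (gauss_weight d \<xi>) * (fourier f \<xi> * cnj (fourier f \<xi>)))
    = (LINT s|lborel. f s * (LINT t|lborel. cnj (f t) * of_real (normal_density 0 (d / (2 * pi)) (s - t))))"
proof -
  have [measurable]: "f \<in> borel_measurable borel" using f by simp
  let ?w = "\<lambda>\<xi>. complex_of_real (gauss_weight d \<xi>)"
  have w: "integrable lborel ?w" using integrable_gauss_weight[OF d] by simp
  have nF: "norm (fourier f \<xi>) \<le> (LINT t|lborel. norm (f t))" for \<xi> by (rule norm_fourier_le)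
  have wF: "integrable lborel (\<lambda>\<xi>. ?w \<xi> * cnj (fourier f \<xi>))"
    by (rule integrable_mult_bounded[OF w, where B="LINT t|lborel. norm (f t)"])
       (use nF in simp_all)
  have inner: "(LINT \<xi>|lborel. ?w \<xi> * cnj (fourier f \<xi>) * cis (- (2 * pi * s * \<xi>)))
      = (LINT t|lborel. cnj (f t) * of_real (normal_density 0 (d / (2 * pi)) (s - t)))" for s
  proof -
    have cF: "cnj (fourier f \<xi>) = (LINT t|lborel. cnj (f t) * cis (2 * pi * t * \<xi>))" for \<xi>
    proof -
      have "cnj (fourier f \<xi>) = (LINT t|lborel. cnj (f t * cis (- (2 * pi * t * \<xi>))))"
        unfolding fourier_cis by (rule Bochner_Integration.integral_cnj[symmetric])
      then show ?thesis by (simp add: cis_cnj)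
    qed
    have "(LINT \<xi>|lborel. ?w \<xi> * cnj (fourier f \<xi>) * cis (- (2 * pi * s * \<xi>)))
      = (LINT \<xi>|lborel. LINT t|lborel. cnj (f t) * ?w \<xi> * cis (- (2 * pi * (s - t) * \<xi>)))"
    proof (rule Bochner_Integration.integral_cong[OF refl])
      fix \<xi>
      have "?w \<xi> * cnj (fourier f \<xi>) * cis (- (2 * pi * s * \<xi>))
        = (LINT t|lborel. (?w \<xi> * cis (- (2 * pi * s * \<xi>))) * (cnj (f t) * cis (2 * pi * t * \<xi>)))"
        by (simp add: cF)
      also have "\<dots> = (LINT t|lborel. cnj (f t) * ?w \<xi> * cis (- (2 * pi * (s - t) * \<xi>)))"
      proof (rule Bochner_Integration.integral_cong[OF refl])
        fix t
        have "cis (- (2 * pi * (s - t) * \<xi>)) = cis (- (2 * pi * s * \<xi>)) * cis (2 * pi * t * \<xi>)"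
          by (simp add: cis_mult algebra_simps)
        then show "?w \<xi> * cis (- (2 * pi * s * \<xi>)) * (cnj (f t) * cis (2 * pi * t * \<xi>))
          = cnj (f t) * ?w \<xi> * cis (- (2 * pi * (s - t) * \<xi>))"
          by (simp only: mult_ac)
      qed
      finally show "?w \<xi> * cnj (fourier f \<xi>) * cis (- (2 * pi * s * \<xi>)) = \<dots>" .
    qed
    also have "\<dots> = (LINT t|lborel. LINT \<xi>|lborel. cnj (f t) * ?w \<xi> * cis (- (2 * pi * (s - t) * \<xi>)))"
      by (rule lborel_pair.Fubini_integral, rule integrable_mult_pair_bounded[where B=1])
         (use f w in auto)
    also have "\<dots> = (LINT t|lborel. cnj (f t) * of_real (normal_density 0 (d / (2 * pi)) (s - t)))"
      by (simp only: mult.assoc[of "cnj _"] integral_mult_right_zero fourier_gauss_weight[OF d])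
    finally show ?thesis .
  qed
  have "(LINT \<xi>|lborel. ?w \<xi> * (fourier f \<xi> * cnj (fourier f \<xi>)))
     = (LINT \<xi>|lborel. LINT s|lborel. f s * (?w \<xi> * cnj (fourier f \<xi>)) * cis (- (2 * pi * s * \<xi>)))"
  proof (rule Bochner_Integration.integral_cong[OF refl])
    fix \<xi>
    have "?w \<xi> * (fourier f \<xi> * cnj (fourier f \<xi>))
      = (LINT s|lborel. (?w \<xi> * cnj (fourier f \<xi>)) * (f s * cis (- (2 * pi * s * \<xi>))))"
      by (simp add: fourier_cis)
    then show "?w \<xi> * (fourier f \<xi> * cnj (fourier f \<xi>))
      = (LINT s|lborel. f s * (?w \<xi> * cnj (fourier f \<xi>)) * cis (- (2 * pi * s * \<xi>)))"
      by (simp only: mult_ac)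
  qed
  also have "\<dots> = (LINT s|lborel. LINT \<xi>|lborel. f s * (?w \<xi> * cnj (fourier f \<xi>)) * cis (- (2 * pi * s * \<xi>)))"
    by (rule lborel_pair.Fubini_integral, rule integrable_mult_pair_bounded[where B=1])
       (use f wF in auto)
  finally show ?thesis by (simp only: mult.assoc[of "f _"] integral_mult_right_zero inner)
qed

section \<open>The Fourier integral does not increase the energy\<close>

definition energy :: "(real \<Rightarrow> complex) \<Rightarrow> ennreal" where
  "energy f = (\<integral>\<^sup>+ x. ennreal ((cmod (f x))\<^sup>2) \<partial>lborel)"

text \<open>If \<open>f\<close> is not integrable, its Bochner integral is 0 by convention and the
  bound is trivial. Estimates can thus pass to \<open>ennreal\<close> without an integrability
  condition.\<close>

lemma norm_integral_le_nn_integral: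
  fixes f :: "'a \<Rightarrow> 'b :: {banach, second_countable_topology}"
  shows "ennreal (norm (integral\<^sup>L M f)) \<le> (\<integral>\<^sup>+ x. ennreal (norm (f x)) \<partial>M)"
  by (cases "integrable M f") (auto intro: integral_norm_bound_ennreal simp: not_integrable_integral_eq)

text \<open>Both marginals of the convolution kernel have mass 1, which is what the Schur test below
  requires.\<close>

lemma nn_integral_normal_density_shift:
  assumes "0 < \<sigma>"
  shows "(\<integral>\<^sup>+ t. ennreal (normal_density 0 \<sigma> (s - t)) \<partial>lborel) = 1"
    and "(\<integral>\<^sup>+ s. ennreal (normal_density 0 \<sigma> (s - t)) \<partial>lborel) = 1"
proof -
  have 1: "(\<integral>\<^sup>+ t. ennreal (normal_density 0 \<sigma> t) \<partial>lborel) = 1"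
    using assms by (subst nn_integral_eq_integral) auto
  show "(\<integral>\<^sup>+ t. ennreal (normal_density 0 \<sigma> (s - t)) \<partial>lborel) = 1"
    using nn_integral_real_affine[of "\<lambda>t. ennreal (normal_density 0 \<sigma> t)" "-1" s] 1 by simp
  show "(\<integral>\<^sup>+ s. ennreal (normal_density 0 \<sigma> (s - t)) \<partial>lborel) = 1"
    using nn_integral_real_affine[of "\<lambda>t. ennreal (normal_density 0 \<sigma> t)" "1" "-t"] 1 by simp
qed

text \<open>The damped integral is real, nonnegative and finite, because the weight is integrable
  and the transform bounded. Taking the modulus in \<open>fourier_weighted_norm\<close> therefore
  loses nothing.\<close>

lemma fourier_weighted_energy:
  assumes f: "integrable lborel f" and d: "0 < d"
  shows "(\<integral>\<^sup>+ \<xi>. ennreal (gauss_weight d \<xi> * (cmod (fourier f \<xi>))\<^sup>2) \<partial>lborel)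
    = ennreal (cmod (LINT s|lborel. f s *
        (LINT t|lborel. cnj (f t) * of_real (normal_density 0 (d / (2 * pi)) (s - t)))))"
proof -
  have [measurable]: "f \<in> borel_measurable borel" using f by simp
  define B where "B = (LINT t|lborel. norm (f t))"
  have B: "norm (fourier f \<xi>) \<le> B" for \<xi> unfolding B_def by (rule norm_fourier_le)
  have int: "integrable lborel (\<lambda>\<xi>. gauss_weight d \<xi> * (cmod (fourier f \<xi>))\<^sup>2)"
  proof (rule Bochner_Integration.integrable_bound)
    show "integrable lborel (\<lambda>\<xi>. B\<^sup>2 * gauss_weight d \<xi>)"
      using integrable_gauss_weight[OF d] by simp
    have "norm (gauss_weight d \<xi> * (cmod (fourier f \<xi>))\<^sup>2) \<le> norm (B\<^sup>2 * gauss_weight d \<xi>)" for \<xi>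
      using mult_right_mono[OF power_mono[OF B, of \<xi> 2] gauss_weight_nonneg[of d \<xi>]]
      by (simp add: abs_mult gauss_weight_nonneg mult.commute)
    then show "AE \<xi> in lborel. norm (gauss_weight d \<xi> * (cmod (fourier f \<xi>))\<^sup>2) \<le> norm (B\<^sup>2 * gauss_weight d \<xi>)"
      by simp
  qed measurable
  have "(LINT \<xi>|lborel. of_real (gauss_weight d \<xi>) * (fourier f \<xi> * cnj (fourier f \<xi>)))
    = of_real (LINT \<xi>|lborel. gauss_weight d \<xi> * (cmod (fourier f \<xi>))\<^sup>2)"
    unfolding complex_norm_square[symmetric] of_real_mult[symmetric] by (rule integral_complex_of_real)
  moreover have "0 \<le> (LINT \<xi>|lborel. gauss_weight d \<xi> * (cmod (fourier f \<xi>))\<^sup>2)"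
    by (simp add: gauss_weight_nonneg)
  moreover have "(\<integral>\<^sup>+ \<xi>. ennreal (gauss_weight d \<xi> * (cmod (fourier f \<xi>))\<^sup>2) \<partial>lborel)
    = ennreal (LINT \<xi>|lborel. gauss_weight d \<xi> * (cmod (fourier f \<xi>))\<^sup>2)"
    using int by (intro nn_integral_eq_integral) (auto simp: gauss_weight_nonneg)
  ultimately show ?thesis unfolding fourier_weighted_norm[OF f d, symmetric] by simp
qed

text \<open>A Schur test: the product \<open>cmod (f s) * cmod (f t)\<close> is at most the mean of
  the two squares, and each square is integrated against a kernel of mass 1 in the other variable.
  The value \<open>energy f\<close> may be infinite.\<close>

lemma fourier_weighted_energy_le:
  assumes f: "integrable lborel f" and d: "0 < d"
  shows "(\<integral>\<^sup>+ \<xi>. ennreal (gauss_weight d \<xi> * (cmod (fourier f \<xi>))\<^sup>2) \<partial>lborel) \<le> energy f"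
proof -
  have [measurable]: "f \<in> borel_measurable borel" using f by simp
  define \<sigma> where "\<sigma> = d / (2 * pi)"
  have \<sigma>: "0 < \<sigma>" using d by (simp add: \<sigma>_def)
  let ?K = "\<lambda>s t. normal_density 0 \<sigma> (s - t)"
  have "(\<integral>\<^sup>+ \<xi>. ennreal (gauss_weight d \<xi> * (cmod (fourier f \<xi>))\<^sup>2) \<partial>lborel)
    = ennreal (cmod (LINT s|lborel. f s * (LINT t|lborel. cnj (f t) * of_real (?K s t))))"
    using fourier_weighted_energy[OF f d] by (simp add: \<sigma>_def)
  also have "\<dots> \<le> (\<integral>\<^sup>+ s. ennreal (cmod (f s * (LINT t|lborel. cnj (f t) * of_real (?K s t)))) \<partial>lborel)"
    by (rule norm_integral_le_nn_integral)
  also have "\<dots> \<le> (\<integral>\<^sup>+ s. \<integral>\<^sup>+ t. ennreal (cmod (f s)) * ennreal (cmod (f t) * ?K s t) \<partial>lborel \<partial>lborel)"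
  proof (rule nn_integral_mono)
    fix s
    have "ennreal (cmod (f s * (LINT t|lborel. cnj (f t) * of_real (?K s t))))
      = ennreal (cmod (f s)) * ennreal (cmod (LINT t|lborel. cnj (f t) * of_real (?K s t)))"
      by (simp add: norm_mult ennreal_mult)
    also have "\<dots> \<le> ennreal (cmod (f s)) * (\<integral>\<^sup>+ t. ennreal (cmod (f t) * ?K s t) \<partial>lborel)"
      using norm_integral_le_nn_integral[of lborel "\<lambda>t. cnj (f t) * of_real (?K s t)"]
      by (intro mult_left_mono) (auto simp: norm_mult)
    also have "\<dots> = (\<integral>\<^sup>+ t. ennreal (cmod (f s)) * ennreal (cmod (f t) * ?K s t) \<partial>lborel)"
      by (rule nn_integral_cmult[symmetric]) simp
    finally show "ennreal (cmod (f s * (LINT t|lborel. cnj (f t) * of_real (?K s t)))) \<le> \<dots>" .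
  qed
  also have "\<dots> \<le> (\<integral>\<^sup>+ s. \<integral>\<^sup>+ t. ennreal ((cmod (f s))\<^sup>2 / 2) * ennreal (?K s t)
      + ennreal ((cmod (f t))\<^sup>2 / 2) * ennreal (?K s t) \<partial>lborel \<partial>lborel)"
  proof (intro nn_integral_mono)
    fix s t
    have "2 * (cmod (f s) * cmod (f t)) \<le> (cmod (f s))\<^sup>2 + (cmod (f t))\<^sup>2"
      using sum_squares_bound[of "cmod (f s)" "cmod (f t)"] by simp
    then have "cmod (f s) * cmod (f t) * ?K s t \<le> ((cmod (f s))\<^sup>2 / 2 + (cmod (f t))\<^sup>2 / 2) * ?K s t"
      by (intro mult_right_mono) auto
    then have "ennreal (cmod (f s) * cmod (f t) * ?K s t)
        \<le> ennreal (((cmod (f s))\<^sup>2 / 2 + (cmod (f t))\<^sup>2 / 2) * ?K s t)"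
      by (rule ennreal_leI)
    moreover have "ennreal (cmod (f s)) * ennreal (cmod (f t) * ?K s t)
        = ennreal (cmod (f s) * cmod (f t) * ?K s t)"
      by (simp add: mult.assoc flip: ennreal_mult)
    moreover have "ennreal (((cmod (f s))\<^sup>2 / 2 + (cmod (f t))\<^sup>2 / 2) * ?K s t)
        = ennreal ((cmod (f s))\<^sup>2 / 2) * ennreal (?K s t) + ennreal ((cmod (f t))\<^sup>2 / 2) * ennreal (?K s t)"
      by (simp only: distrib_right ennreal_plus ennreal_mult normal_density_nonneg
          divide_nonneg_pos zero_le_power2 zero_less_numeral mult_nonneg_nonneg)
    ultimately show "ennreal (cmod (f s)) * ennreal (cmod (f t) * ?K s t)
      \<le> ennreal ((cmod (f s))\<^sup>2 / 2) * ennreal (?K s t) + ennreal ((cmod (f t))\<^sup>2 / 2) * ennreal (?K s t)"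
      by simp
  qed
  also have "\<dots> = (\<integral>\<^sup>+ s. \<integral>\<^sup>+ t. ennreal ((cmod (f s))\<^sup>2 / 2) * ennreal (?K s t) \<partial>lborel \<partial>lborel)
      + (\<integral>\<^sup>+ s. \<integral>\<^sup>+ t. ennreal ((cmod (f t))\<^sup>2 / 2) * ennreal (?K s t) \<partial>lborel \<partial>lborel)"
    by (simp add: nn_integral_add)
  also have "(\<integral>\<^sup>+ s. \<integral>\<^sup>+ t. ennreal ((cmod (f s))\<^sup>2 / 2) * ennreal (?K s t) \<partial>lborel \<partial>lborel)
      = (\<integral>\<^sup>+ s. ennreal ((cmod (f s))\<^sup>2 / 2) \<partial>lborel)"
    by (simp add: nn_integral_cmult nn_integral_normal_density_shift[OF \<sigma>])
  also have "(\<integral>\<^sup>+ s. \<integral>\<^sup>+ t. ennreal ((cmod (f t))\<^sup>2 / 2) * ennreal (?K s t) \<partial>lborel \<partial>lborel)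
      = (\<integral>\<^sup>+ t. \<integral>\<^sup>+ s. ennreal ((cmod (f t))\<^sup>2 / 2) * ennreal (?K s t) \<partial>lborel \<partial>lborel)"
    by (rule lborel_pair.Fubini'[symmetric]) measurable
  also have "\<dots> = (\<integral>\<^sup>+ s. ennreal ((cmod (f s))\<^sup>2 / 2) \<partial>lborel)"
    by (simp add: nn_integral_cmult nn_integral_normal_density_shift[OF \<sigma>])
  also have "(\<integral>\<^sup>+ s. ennreal ((cmod (f s))\<^sup>2 / 2) \<partial>lborel) + (\<integral>\<^sup>+ s. ennreal ((cmod (f s))\<^sup>2 / 2) \<partial>lborel)
      = energy f"
    unfolding energy_def by (simp flip: nn_integral_add ennreal_plus)
  finally show ?thesis .
qed

text \<open>The damping is removed along \<open>d = 1 / real (Suc n)\<close>: the weights tend to 1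
  pointwise, and Fatou's lemma carries the uniform bound to the limit.\<close>

lemma energy_fourier_le:
  assumes f: "integrable lborel f"
  shows "energy (fourier f) \<le> energy f"
proof -
  have [measurable]: "f \<in> borel_measurable borel" using f by simp
  let ?u = "\<lambda>n \<xi>. ennreal (gauss_weight (1 / real (Suc n)) \<xi> * (cmod (fourier f \<xi>))\<^sup>2)"
  have "(\<lambda>n. ?u n \<xi>) \<longlonglongrightarrow> ennreal ((cmod (fourier f \<xi>))\<^sup>2)" for \<xi>
  proof -
    have "(\<lambda>n. exp (- (1 / real (Suc n) * \<xi>)\<^sup>2 / 2) * (cmod (fourier f \<xi>))\<^sup>2)
      \<longlonglongrightarrow> exp (- (0 * \<xi>)\<^sup>2 / 2) * (cmod (fourier f \<xi>))\<^sup>2"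
      by (intro tendsto_intros lim_1_over_n[THEN LIMSEQ_Suc]) auto
    then show ?thesis by (intro tendsto_ennrealI) (simp add: gauss_weight_def)
  qed
  then have "energy (fourier f) = (\<integral>\<^sup>+ \<xi>. liminf (\<lambda>n. ?u n \<xi>) \<partial>lborel)"
    unfolding energy_def by (intro nn_integral_cong) (metis lim_imp_Liminf sequentially_bot)
  also have "\<dots> \<le> liminf (\<lambda>n. \<integral>\<^sup>+ \<xi>. ?u n \<xi> \<partial>lborel)"
    by (rule nn_integral_liminf) measurable
  also have "\<dots> \<le> liminf (\<lambda>n. energy f)"
    by (intro Liminf_mono always_eventually allI fourier_weighted_energy_le[OF f]) simp
  also have "\<dots> = energy f" by (simp add: Liminf_const)
  finally show ?thesis .
qed

text \<open>The other half of Plancherel. As the kernel concentrates, the quadratic form in the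
  damped identity tends to the energy of \<open>f\<close>; as the weight is at most 1, it stays
  below \<open>energy (fourier f)\<close>. Continuity gives the pointwise limit and boundedness the
  domination.\<close>

lemma energy_le_energy_fourier_continuous:
  assumes f: "integrable lborel f" and cont: "continuous_on UNIV f" and B: "\<And>x. norm (f x) \<le> B"
  shows "energy f \<le> energy (fourier f)"
proof -
  have [measurable]: "f \<in> borel_measurable borel" using f by simp
  define \<sigma> where "\<sigma> n = 1 / real (Suc n)" for n
  have \<sigma>: "0 < \<sigma> n" for n by (simp add: \<sigma>_def)
  have \<sigma>0: "\<sigma> \<longlonglongrightarrow> 0" unfolding \<sigma>_def by (rule lim_1_over_n[THEN LIMSEQ_Suc])
  \<comment> \<open>The substitution \<open>t = s - \<sigma> n * v\<close> moves the shrinking width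
    from the kernel into the argument of \<open>f\<close>, so that one fixed density serves for all
    \<open>n\<close>.\<close>
  define J where "J n s = (LINT v|lborel. cnj (f (s - \<sigma> n * v)) * of_real (std_normal_density v))" for n s
  have J: "(LINT t|lborel. cnj (f t) * of_real (normal_density 0 (\<sigma> n) (s - t))) = J n s" for n s
    using \<sigma>[of n] unfolding J_def
    by (subst lborel_integral_real_affine[where c="- \<sigma> n" and t=s])
       (simp_all add: normal_density_def real_sqrt_mult power_mult_distrib scaleR_conv_of_real
           field_simps flip: integral_mult_right_zero)
  have [measurable]: "J n \<in> borel_measurable borel" for n unfolding J_def by measurable
  have wint: "integrable lborel (\<lambda>v. B * std_normal_density v)" by simp
  have bnd: "norm (cnj (f (s - \<sigma> n * v)) * of_real (std_normal_density v)) \<le> B * std_normal_density v" for n s v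
    using mult_right_mono[OF B[of "s - \<sigma> n * v"] normal_density_nonneg[of 0 1 v]] by (simp add: norm_mult)
  have Jlim: "(\<lambda>n. J n s) \<longlonglongrightarrow> cnj (f s)" for s
  proof -
    have "(\<lambda>n. J n s) \<longlonglongrightarrow> (LINT v|lborel. cnj (f s) * of_real (std_normal_density v))"
      unfolding J_def
    proof (rule integral_dominated_convergence[OF _ _ wint])
      have "(\<lambda>n. cnj (f (s - \<sigma> n * v)) * of_real (std_normal_density v)) \<longlonglongrightarrow>
         cnj (f (s - 0 * v)) * of_real (std_normal_density v)" for v
        by (intro tendsto_intros continuous_on_tendsto_compose[OF cont] \<sigma>0) auto
      then show "AE v in lborel. (\<lambda>n. cnj (f (s - \<sigma> n * v)) * of_real (std_normal_density v))
        \<longlonglongrightarrow> cnj (f s) * of_real (std_normal_density v)" by simp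
    qed (use bnd in auto)
    then show ?thesis by simp
  qed
  have Jbnd: "norm (J n s) \<le> B" for n s
  proof -
    have "norm (J n s) \<le> (LINT v|lborel. B * std_normal_density v)"
      unfolding J_def
    proof (rule Bochner_Integration.integral_norm_bound_integral[OF _ wint bnd])
      show "integrable lborel (\<lambda>v. cnj (f (s - \<sigma> n * v)) * of_real (std_normal_density v))"
        by (rule Bochner_Integration.integrable_bound[OF wint])
           (use order.trans[OF bnd abs_ge_self] in auto)
    qed
    then show ?thesis by simp
  qed
  have fbnd: "integrable lborel (\<lambda>s. B * norm (f s))" using f by simp
  have *: "norm (f s * c) \<le> B * norm (f s)" if "norm c \<le> B" for s c
    using mult_left_mono[OF that norm_ge_zero[of "f s"]] by (simp add: norm_mult mult.commute)
  have lim: "(\<lambda>n. LINT s|lborel. f s * J n s) \<longlonglongrightarrow> (LINT s|lborel. f s * cnj (f s))"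
    by (rule integral_dominated_convergence[OF _ _ fbnd])
       (use * Jbnd in \<open>auto intro!: tendsto_intros Jlim\<close>)
  have int2: "integrable lborel (\<lambda>s. (cmod (f s))\<^sup>2)"
    by (rule Bochner_Integration.integrable_bound[OF fbnd])
       (use *[of "cnj (f _)"] B in \<open>auto simp: norm_mult power2_eq_square intro: order.trans[OF _ abs_ge_self]\<close>)
  have "(LINT s|lborel. f s * cnj (f s)) = of_real (LINT s|lborel. (cmod (f s))\<^sup>2)"
    unfolding complex_norm_square[symmetric] by (rule integral_complex_of_real)
  then have "ennreal (cmod (LINT s|lborel. f s * cnj (f s))) = energy f"
    unfolding energy_def using int2 by (simp add: nn_integral_eq_integral)
  moreover have "ennreal (cmod (LINT s|lborel. f s * J n s)) \<le> energy (fourier f)" for n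
  proof -
    \<comment> \<open>The damping parameter \<open>2 * pi * \<sigma> n\<close> is the one whose
      kernel has standard deviation \<open>\<sigma> n\<close>.\<close>
    have "ennreal (cmod (LINT s|lborel. f s * J n s))
      = (\<integral>\<^sup>+ \<xi>. ennreal (gauss_weight (2 * pi * \<sigma> n) \<xi> * (cmod (fourier f \<xi>))\<^sup>2) \<partial>lborel)"
      by (subst fourier_weighted_energy[OF f]) (use \<sigma> in \<open>simp_all add: J\<close>)
    also have "\<dots> \<le> energy (fourier f)"
      unfolding energy_def
      by (intro nn_integral_mono ennreal_leI) (simp add: gauss_weight_le_1 mult_left_le_one_le gauss_weight_nonneg)
    finally show ?thesis .
  qed
  then have "ennreal (cmod (LINT s|lborel. f s * cnj (f s))) \<le> energy (fourier f)"
    by (intro LIMSEQ_le_const2[OF tendsto_ennrealI[OF tendsto_norm[OF lim]]]) auto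
  ultimately show ?thesis by simp
qed

section \<open>From continuous functions to measurable functions with a majorant\<close>

lemma norm_add_square_le:
  fixes a b :: "'a :: real_normed_vector"
  assumes "0 < \<eta>"
  shows "(norm (a + b))\<^sup>2 \<le> (1 + \<eta>) * (norm a)\<^sup>2 + (1 + 1 / \<eta>) * (norm b)\<^sup>2"
proof -
  have "(norm (a + b))\<^sup>2 \<le> (norm a + norm b)\<^sup>2"
    by (intro power_mono norm_triangle_ineq) simp
  \<comment> \<open>Expanded, this square is Young's inequality for the cross term. A free
    \<open>\<eta>\<close> permits a coefficient close to 1 on the dominant summand.\<close>
  moreover have "0 \<le> (\<eta> * norm a - norm b)\<^sup>2 / \<eta>" using assms by simp
  then have "2 * norm a * norm b \<le> \<eta> * (norm a)\<^sup>2 + (norm b)\<^sup>2 / \<eta>"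
    using assms by (simp add: power2_eq_square field_simps)
  ultimately show ?thesis by (simp add: power2_eq_square algebra_simps)
qed

lemma energy_add_le:
  assumes [measurable]: "f \<in> borel_measurable borel" "g \<in> borel_measurable borel" and \<eta>: "0 < \<eta>"
  shows "energy (\<lambda>x. f x + g x) \<le> ennreal (1 + \<eta>) * energy f + ennreal (1 + 1 / \<eta>) * energy g"
proof -
  have "energy (\<lambda>x. f x + g x)
    \<le> (\<integral>\<^sup>+ x. ennreal (1 + \<eta>) * ennreal ((cmod (f x))\<^sup>2) + ennreal (1 + 1 / \<eta>) * ennreal ((cmod (g x))\<^sup>2) \<partial>lborel)"
    unfolding energy_def
  proof (rule nn_integral_mono)
    fix x
    show "ennreal ((cmod (f x + g x))\<^sup>2)
      \<le> ennreal (1 + \<eta>) * ennreal ((cmod (f x))\<^sup>2) + ennreal (1 + 1 / \<eta>) * ennreal ((cmod (g x))\<^sup>2)"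
      using ennreal_leI[OF norm_add_square_le[OF \<eta>, of "f x" "g x"]] \<eta>
      by (simp add: ennreal_plus ennreal_mult)
  qed
  also have "\<dots> = ennreal (1 + \<eta>) * energy f + ennreal (1 + 1 / \<eta>) * energy g"
    unfolding energy_def by (simp add: nn_integral_add nn_integral_cmult)
  finally show ?thesis .
qed

text \<open>Truncating at the majorant keeps an almost everywhere approximation by continuous functions
  dominated.\<close>

lemma continuous_energy_approximation:
  fixes f :: "real \<Rightarrow> complex" and g :: "real \<Rightarrow> real"
  assumes [measurable]: "f \<in> borel_measurable borel"
    and g_cont: "continuous_on UNIV g" and g_pos: "\<And>x. 0 < g x"
    and g2: "integrable lborel (\<lambda>x. (g x)\<^sup>2)"
    and dom: "AE x in lborel. cmod (f x) \<le> g x"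
  obtains h where "\<And>n. continuous_on UNIV (h n)" "\<And>n x. cmod (h n x) \<le> g x"
    "(\<lambda>n. energy (h n)) \<longlonglongrightarrow> energy f" "(\<lambda>n. energy (\<lambda>x. h n x - f x)) \<longlonglongrightarrow> 0"
proof -
  have [measurable]: "g \<in> borel_measurable borel"
    using g_cont by (rule borel_measurable_continuous_onI)
  \<comment> \<open>Being \<open>measurable_on\<close> supplies continuous functions that converge
    to \<open>f\<close> pointwise off a negligible set.\<close>
  have "f measurable_on UNIV"
    by (subst measurable_on_iff_borel_measurable) (auto simp: lebesgue_on_UNIV_eq intro: measurable_completion)
  then obtain N \<phi> where N: "negligible N" and \<phi>_cont: "\<And>n. continuous_on UNIV (\<phi> n)"
    and \<phi>_lim: "\<And>x. x \<notin> N \<Longrightarrow> (\<lambda>n. \<phi> n x) \<longlonglongrightarrow> f x"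
    unfolding measurable_on_def by auto
  have \<phi>_ae: "AE x in lborel. (\<lambda>n. \<phi> n x) \<longlonglongrightarrow> f x"
  proof -
    have "AE x in lebesgue. x \<notin> N" using N by (simp add: negligible_iff_null_sets AE_not_in)
    then have "AE x in lborel. x \<notin> N" by (simp add: AE_completion_iff)
    then show ?thesis by eventually_elim (rule \<phi>_lim)
  qed
  define h where "h n x = \<phi> n x * of_real (g x / max (g x) (cmod (\<phi> n x)))" for n x
  have max_pos: "0 < max (g x) c" for x c using g_pos[of x] by simp
  have h_cont: "continuous_on UNIV (h n)" for n
    unfolding h_def
    by (intro continuous_intros g_cont \<phi>_cont ballI less_imp_neq[symmetric] max_pos)
  have h_le: "cmod (h n x) \<le> g x" for n x
  proof -
    have "cmod (\<phi> n x) * g x \<le> max (g x) (cmod (\<phi> n x)) * g x"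
      using g_pos[of x] by (intro mult_right_mono) auto
    then show ?thesis using max_pos[of x "cmod (\<phi> n x)"] g_pos[of x]
      by (simp add: h_def norm_mult norm_divide divide_simps mult.commute del: max_less_iff_conj less_max_iff_disj)
  qed
  have [measurable]: "h n \<in> borel_measurable borel" for n
    using h_cont by (rule borel_measurable_continuous_onI)
  have h_lim: "AE x in lborel. (\<lambda>n. h n x) \<longlonglongrightarrow> f x"
    using \<phi>_ae dom
  proof eventually_elim
    case (elim x)
    \<comment> \<open>Positivity of \<open>g\<close> keeps the denominator away from 0, and
      \<open>cmod (f x) \<le> g x\<close> makes the limiting factor 1.\<close>
    have "(\<lambda>n. h n x) \<longlonglongrightarrow> f x * of_real (g x / max (g x) (cmod (f x)))"
      unfolding h_def using max_pos[of x "cmod (f x)"]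
      by (intro tendsto_intros elim(1)) linarith
    then show ?case using elim(2) g_pos[of x] by (simp add: max_absorb1)
  qed
  have fin: "(\<integral>\<^sup>+ x. ennreal (c * (g x)\<^sup>2) \<partial>lborel) < \<infinity>" if "0 \<le> c" for c
    using g2 that by (subst nn_integral_eq_integral) auto
  have 1: "(\<lambda>n. energy (h n)) \<longlonglongrightarrow> energy f"
    unfolding energy_def
  proof (rule nn_integral_dominated_convergence[OF _ _ _ _ fin[of 1]])
    show "AE x in lborel. ennreal ((cmod (h n x))\<^sup>2) \<le> ennreal (1 * (g x)\<^sup>2)" for n
      using h_le by (auto intro!: ennreal_leI power_mono)
    show "AE x in lborel. (\<lambda>n. ennreal ((cmod (h n x))\<^sup>2)) \<longlonglongrightarrow> ennreal ((cmod (f x))\<^sup>2)"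
      using h_lim by eventually_elim (intro tendsto_ennrealI tendsto_intros)
  qed auto
  have "(\<lambda>n. energy (\<lambda>x. h n x - f x)) \<longlonglongrightarrow> (\<integral>\<^sup>+ x. 0 \<partial>(lborel :: real measure))"
    unfolding energy_def
  proof (rule nn_integral_dominated_convergence[OF _ _ _ _ fin[of 4]])
    show "AE x in lborel. ennreal ((cmod (h n x - f x))\<^sup>2) \<le> ennreal (4 * (g x)\<^sup>2)" for n
      using dom
    proof eventually_elim
      case (elim x)
      have "cmod (h n x - f x) \<le> 2 * g x"
        using norm_triangle_ineq4[of "h n x" "f x"] h_le[of n x] elim by linarith
      then have "(cmod (h n x - f x))\<^sup>2 \<le> (2 * g x)\<^sup>2" by (intro power_mono) auto
      then show ?case by (intro ennreal_leI) (simp add: power_mult_distrib)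
    qed
    show "AE x in lborel. (\<lambda>n. ennreal ((cmod (h n x - f x))\<^sup>2)) \<longlonglongrightarrow> 0"
      using h_lim
    proof eventually_elim
      case (elim x)
      have "(\<lambda>n. (cmod (h n x - f x))\<^sup>2) \<longlonglongrightarrow> (cmod (f x - f x))\<^sup>2"
        by (intro tendsto_intros elim)
      then show ?case using tendsto_ennrealI by fastforce
    qed
  qed auto
  then have 2: "(\<lambda>n. energy (\<lambda>x. h n x - f x)) \<longlonglongrightarrow> 0" by simp
  show thesis by (rule that[OF h_cont h_le 1 2])
qed

text \<open>Lets \<open>\<eta>\<close> tend to 0, which removes the factor \<open>1 + \<eta>\<close>
  introduced by \<open>energy_add_le\<close>.\<close>

lemma ennreal_le_of_all_dilations:
  fixes x y :: ennreal
  assumes "\<And>\<eta>. 0 < \<eta> \<Longrightarrow> x \<le> ennreal (1 + \<eta>) * y"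
  shows "x \<le> y"
proof (cases "y = \<top>")
  case False
  have "(\<lambda>n. ennreal (1 + 1 / real (Suc n)) * y) \<longlonglongrightarrow> ennreal (1 + 0) * y"
    using False by (intro tendsto_mult_ennreal tendsto_ennrealI tendsto_intros lim_1_over_n[THEN LIMSEQ_Suc]) auto
  then show ?thesis
    by (intro LIMSEQ_le_const) (use assms in auto)
qed simp

text \<open>Continuous functions below the majorant approximate \<open>f\<close>, and
  \<open>energy_fourier_le\<close> controls the transform of the error. First \<open>n\<close> goes
  to infinity at fixed \<open>\<eta>\<close>, which kills the term with the large coefficient
  \<open>1 + 1 / \<eta>\<close>; only then does \<open>\<eta>\<close> tend to 0.\<close>

lemma energy_le_energy_fourier:
  fixes f :: "real \<Rightarrow> complex" and g :: "real \<Rightarrow> real"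
  assumes [measurable]: "f \<in> borel_measurable borel"
    and g_cont: "continuous_on UNIV g" and g_pos: "\<And>x. 0 < g x" and g_le: "\<And>x. g x \<le> B"
    and g_int: "integrable lborel g"
    and dom: "AE x in lborel. cmod (f x) \<le> g x"
  shows "energy f \<le> energy (fourier f)"
proof (rule ennreal_le_of_all_dilations)
  fix \<eta> :: real assume \<eta>: "0 < \<eta>"
  have [measurable]: "g \<in> borel_measurable borel"
    using g_cont by (rule borel_measurable_continuous_onI)
  have "integrable lborel (\<lambda>x. (g x)\<^sup>2)"
  proof (rule Bochner_Integration.integrable_bound)
    show "integrable lborel (\<lambda>x. B * g x)" using g_int by simp
    show "AE x in lborel. norm ((g x)\<^sup>2) \<le> norm (B * g x)"
    proof (rule AE_I2)
      fix x
      have "(g x)\<^sup>2 \<le> B * g x"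
        using mult_right_mono[OF g_le less_imp_le[OF g_pos], of x x] by (simp add: power2_eq_square)
      then show "norm ((g x)\<^sup>2) \<le> norm (B * g x)" by simp
    qed
  qed measurable
  then obtain h where h: "\<And>n. continuous_on UNIV (h n)" "\<And>n x. cmod (h n x) \<le> g x"
    "(\<lambda>n. energy (h n)) \<longlonglongrightarrow> energy f" "(\<lambda>n. energy (\<lambda>x. h n x - f x)) \<longlonglongrightarrow> 0"
    using continuous_energy_approximation[OF assms(1) g_cont g_pos _ dom] by blast
  have [measurable]: "h n \<in> borel_measurable borel" for n
    using h(1) by (rule borel_measurable_continuous_onI)
  have f_int: "integrable lborel f"
    by (rule Bochner_Integration.integrable_bound[OF g_int]) (use dom g_pos in \<open>auto simp: less_imp_le\<close>)
  have h_int: "integrable lborel (h n)" for n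
    by (rule Bochner_Integration.integrable_bound[OF g_int]) (use h(2) g_pos in \<open>auto simp: less_imp_le\<close>)
  have "energy (h n) \<le> ennreal (1 + \<eta>) * energy (fourier f)
      + ennreal (1 + 1 / \<eta>) * energy (\<lambda>x. h n x - f x)" for n
  proof -
    have "energy (h n) \<le> energy (fourier (h n))"
      by (rule energy_le_energy_fourier_continuous[OF h_int h(1) order.trans[OF h(2) g_le]])
    also have "fourier (h n) = (\<lambda>\<xi>. fourier f \<xi> + fourier (\<lambda>x. h n x - f x) \<xi>)"
      by (simp add: fourier_diff[OF h_int f_int])
    also have "energy \<dots> \<le> ennreal (1 + \<eta>) * energy (fourier f)
        + ennreal (1 + 1 / \<eta>) * energy (fourier (\<lambda>x. h n x - f x))"
      by (intro energy_add_le \<eta>) measurable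
    also have "\<dots> \<le> ennreal (1 + \<eta>) * energy (fourier f)
        + ennreal (1 + 1 / \<eta>) * energy (\<lambda>x. h n x - f x)"
      using h_int f_int by (intro add_left_mono mult_left_mono energy_fourier_le) auto
    finally show ?thesis .
  qed
  moreover have "(\<lambda>n. ennreal (1 + \<eta>) * energy (fourier f)
      + ennreal (1 + 1 / \<eta>) * energy (\<lambda>x. h n x - f x))
      \<longlonglongrightarrow> ennreal (1 + \<eta>) * energy (fourier f) + ennreal (1 + 1 / \<eta>) * 0"
    by (intro tendsto_add tendsto_const tendsto_mult_ennreal h(4)) auto
  ultimately show "energy f \<le> ennreal (1 + \<eta>) * energy (fourier f)"
    using LIMSEQ_le[OF h(3)] by fastforce
qed

text \<open>Transfers pointwise bounds from the relational transform to the integral. Both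
  \<open>g\<close> and \<open>fourier f\<close> are limits in energy of the same sequence
  \<open>fourier (F k)\<close>, the latter by \<open>energy_fourier_le\<close> applied to
  \<open>F k - f\<close>.\<close>

lemma has_L2_fourier_AE_eq:
  assumes f: "integrable lborel f" and fg: "has_L2_fourier f g"
  shows "AE \<xi> in lborel. g \<xi> = fourier f \<xi>"
proof -
  obtain F where F: "\<And>k. integrable lborel (F k)" "L2_tendsto F f" "L2_tendsto (\<lambda>k. fourier (F k)) g"
    using fg unfolding has_L2_fourier_def by blast
  have [measurable]: "f \<in> borel_measurable borel" "g \<in> borel_measurable borel"
    "\<And>k. F k \<in> borel_measurable borel"
    using f fg F(1) by (auto simp: has_L2_fourier_def square_integrable_def)
  have bnd: "energy (\<lambda>\<xi>. g \<xi> - fourier f \<xi>)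
      \<le> ennreal 2 * energy (\<lambda>x. fourier (F k) x - g x) + ennreal 2 * energy (\<lambda>x. F k x - f x)" for k
  proof -
    have "energy (\<lambda>\<xi>. g \<xi> - fourier f \<xi>)
      = energy (\<lambda>\<xi>. (g \<xi> - fourier (F k) \<xi>) + fourier (\<lambda>x. F k x - f x) \<xi>)"
      by (simp add: fourier_diff[OF F(1) f])
    also have "\<dots> \<le> ennreal 2 * energy (\<lambda>\<xi>. g \<xi> - fourier (F k) \<xi>)
        + ennreal 2 * energy (fourier (\<lambda>x. F k x - f x))"
      using energy_add_le[of "\<lambda>\<xi>. g \<xi> - fourier (F k) \<xi>" "fourier (\<lambda>x. F k x - f x)" 1] by simp
    also have "\<dots> \<le> ennreal 2 * energy (\<lambda>\<xi>. g \<xi> - fourier (F k) \<xi>)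
        + ennreal 2 * energy (\<lambda>x. F k x - f x)"
      using F(1) f by (intro add_left_mono mult_left_mono energy_fourier_le) auto
    finally show ?thesis by (simp add: energy_def norm_minus_commute)
  qed
  have "(\<lambda>k. ennreal 2 * energy (\<lambda>x. fourier (F k) x - g x) + ennreal 2 * energy (\<lambda>x. F k x - f x))
      \<longlonglongrightarrow> ennreal 2 * 0 + ennreal 2 * 0"
    using F(2,3) unfolding L2_tendsto_def energy_def[symmetric]
    by (intro tendsto_add tendsto_mult_ennreal tendsto_const) auto
  then have "energy (\<lambda>\<xi>. g \<xi> - fourier f \<xi>) \<le> 0"
    using bnd by (intro LIMSEQ_le_const) auto
  then have "energy (\<lambda>\<xi>. g \<xi> - fourier f \<xi>) = 0" by simp
  then have "AE \<xi> in lborel. ennreal ((cmod (g \<xi> - fourier f \<xi>))\<^sup>2) = 0"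
    unfolding energy_def by (subst (asm) nn_integral_0_iff_AE) auto
  then show ?thesis by eventually_elim (simp add: ennreal_eq_0_iff)
qed

section \<open>Bessel's inequality\<close>

lemma square_integrable_cmult:
  "square_integrable f \<Longrightarrow> square_integrable (\<lambda>x. c * f x)"
  unfolding square_integrable_def by (auto simp: norm_mult power_mult_distrib)

lemma square_integrable_add:
  assumes "square_integrable f" "square_integrable g"
  shows "square_integrable (\<lambda>x. f x + g x)"
  unfolding square_integrable_def
proof
  have [measurable]: "f \<in> borel_measurable borel" "g \<in> borel_measurable borel"
    using assms by (auto simp: square_integrable_def)
  show "(\<lambda>x. f x + g x) \<in> borel_measurable lborel" by simp
  show "integrable lborel (\<lambda>x. (cmod (f x + g x))\<^sup>2)"
  proof (rule Bochner_Integration.integrable_bound)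
    show "integrable lborel (\<lambda>x. 2 * (cmod (f x))\<^sup>2 + 2 * (cmod (g x))\<^sup>2)"
      using assms by (auto simp: square_integrable_def)
    show "AE x in lborel. norm ((cmod (f x + g x))\<^sup>2) \<le> norm (2 * (cmod (f x))\<^sup>2 + 2 * (cmod (g x))\<^sup>2)"
      using norm_add_square_le[of 1 "f _" "g _"] by simp
  qed measurable
qed

lemma square_integrable_sum:
  assumes "\<And>n. n \<in> I \<Longrightarrow> square_integrable (f n)"
  shows "square_integrable (\<lambda>x. \<Sum>n\<in>I. f n x)"
  using assms
  by (induction I rule: infinite_finite_induct)
     (auto intro: square_integrable_add simp: square_integrable_def[of "\<lambda>_. 0"])

lemma integrable_mult_cnj:
  assumes "square_integrable f" "square_integrable g"
  shows "integrable lborel (\<lambda>x. f x * cnj (g x))"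
proof (rule Bochner_Integration.integrable_bound)
  show "integrable lborel (\<lambda>x. (cmod (f x))\<^sup>2 + (cmod (g x))\<^sup>2)"
    using assms by (auto simp: square_integrable_def)
  have [measurable]: "f \<in> borel_measurable borel" "g \<in> borel_measurable borel"
    using assms by (auto simp: square_integrable_def)
  show "(\<lambda>x. f x * cnj (g x)) \<in> borel_measurable lborel" by simp
  have "cmod (f x) * cmod (g x) \<le> (cmod (f x))\<^sup>2 + (cmod (g x))\<^sup>2" for x
    using sum_squares_bound[of "cmod (f x)" "cmod (g x)"]
      mult_nonneg_nonneg[OF norm_ge_zero[of "f x"] norm_ge_zero[of "g x"]] by linarith
  then show "AE x in lborel. norm (f x * cnj (g x)) \<le> norm ((cmod (f x))\<^sup>2 + (cmod (g x))\<^sup>2)"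
    by (simp add: norm_mult)
qed

lemma L2_inner_cnj: "cnj (L2_inner f g) = L2_inner g f"
proof -
  have "cnj (L2_inner f g) = (LINT x|lborel. cnj (f x * cnj (g x)))"
    unfolding L2_inner_def by (rule Bochner_Integration.integral_cnj[symmetric])
  then show ?thesis by (simp add: L2_inner_def mult.commute)
qed

lemma L2_inner_self: "L2_inner f f = of_real (LINT x|lborel. (cmod (f x))\<^sup>2)"
  unfolding L2_inner_def complex_norm_square[symmetric] by (rule integral_complex_of_real)

lemma L2_inner_diff_left:
  assumes "square_integrable f" "square_integrable g" "square_integrable h"
  shows "L2_inner (\<lambda>x. f x - g x) h = L2_inner f h - L2_inner g h"
  unfolding L2_inner_def left_diff_distrib using assms by (simp add: integrable_mult_cnj)

lemma L2_inner_sum_left: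
  assumes "\<And>n. n \<in> I \<Longrightarrow> square_integrable (e n)" "square_integrable h"
  shows "L2_inner (\<lambda>x. \<Sum>n\<in>I. c n * e n x) h = (\<Sum>n\<in>I. c n * L2_inner (e n) h)"
  unfolding L2_inner_def sum_distrib_right mult.assoc using assms
  by (subst Bochner_Integration.integral_sum) (auto intro!: Bochner_Integration.integrable_mult_right integrable_mult_cnj)

text \<open>The remainder \<open>D\<close> of \<open>h\<close> after projection is orthogonal to the
  projection \<open>S\<close>, so by Pythagoras the two sides differ by the squared norm of
  \<open>D\<close>.\<close>

lemma bessel_inequality:
  assumes I: "finite I" and e: "orthonormal_family I e" and h: "square_integrable h"
  shows "(\<Sum>n\<in>I. (cmod (L2_inner h (e n)))\<^sup>2) \<le> (LINT x|lborel. (cmod (h x))\<^sup>2)"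
proof -
  define c where "c n = L2_inner h (e n)" for n
  define S where "S x = (\<Sum>n\<in>I. c n * e n x)" for x
  define D where "D x = h x - S x" for x
  have sq: "square_integrable (e n)" if "n \<in> I" for n
    using e that by (auto simp: orthonormal_family_def)
  have S: "square_integrable S"
    unfolding S_def by (intro square_integrable_sum square_integrable_cmult sq)
  have D: "square_integrable D"
    using square_integrable_add[OF h square_integrable_cmult[OF S, of "-1"]] by (simp add: D_def[abs_def])
  have De: "L2_inner D (e n) = 0" if n: "n \<in> I" for n
  proof -
    have "L2_inner S (e n) = (\<Sum>m\<in>I. c m * L2_inner (e m) (e n))"
      unfolding S_def by (rule L2_inner_sum_left) (use sq n in auto)
    also have "\<dots> = (\<Sum>m\<in>I. if m = n then c m else 0)"
      using e n by (intro sum.cong) (auto simp: orthonormal_family_def)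
    also have "\<dots> = c n" using I n by simp
    finally show ?thesis
      unfolding D_def by (simp add: L2_inner_diff_left[OF h S sq[OF n]] c_def)
  qed
  have "L2_inner S D = (\<Sum>n\<in>I. c n * L2_inner (e n) D)"
    unfolding S_def by (rule L2_inner_sum_left) (use sq D in auto)
  then have SD: "L2_inner S D = 0"
    using De L2_inner_cnj[of D] by (metis (no_types, lifting) complex_cnj_zero mult_zero_right sum.neutral)
  \<comment> \<open>Linearity is applied in the first argument, hence the detour through a
    conjugate; it disappears at the end because all the quantities are real.\<close>
  have "of_real (LINT x|lborel. (cmod (D x))\<^sup>2) = L2_inner h D - L2_inner S D"
    unfolding L2_inner_self[symmetric] using L2_inner_diff_left[OF h S D] by (simp add: D_def[abs_def])
  also have "\<dots> = cnj (L2_inner D h)" by (simp add: SD L2_inner_cnj)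
  also have "L2_inner D h = L2_inner h h - L2_inner S h"
    using L2_inner_diff_left[OF h S h] by (simp add: D_def[abs_def])
  also have "L2_inner S h = (\<Sum>n\<in>I. c n * L2_inner (e n) h)"
    unfolding S_def by (rule L2_inner_sum_left) (use sq h in auto)
  also have "\<dots> = of_real (\<Sum>n\<in>I. (cmod (c n))\<^sup>2)"
    by (simp add: c_def complex_norm_square L2_inner_cnj del: of_real_power)
  finally have "(LINT x|lborel. (cmod (D x))\<^sup>2)
      = (LINT x|lborel. (cmod (h x))\<^sup>2) - (\<Sum>n\<in>I. (cmod (c n))\<^sup>2)"
    unfolding L2_inner_self by (metis complex_cnj_complex_of_real of_real_diff of_real_eq_iff)
  moreover have "0 \<le> (LINT x|lborel. (cmod (D x))\<^sup>2)" by simp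
  ultimately show ?thesis by (simp add: c_def)
qed

section \<open>Time and frequency truncation\<close>

lemma gaussian_has_bochner_integral:
  assumes "0 < a"
  shows "has_bochner_integral lborel (\<lambda>x. exp (- pi * a * x\<^sup>2)) (1 / sqrt a)"
proof -
  \<comment> \<open>Solves \<open>1 / (2 * \<sigma>\<^sup>2) = pi * a\<close>, so that the exponents
    agree.\<close>
  define \<sigma> where "\<sigma> = 1 / sqrt (2 * pi * a)"
  have \<sigma>: "0 < \<sigma>" "\<sigma>\<^sup>2 = 1 / (2 * pi * a)"
    using assms by (auto simp: \<sigma>_def power_divide)
  have eq: "exp (- pi * a * x\<^sup>2) = 1 / sqrt a * normal_density 0 \<sigma> x" for x
    unfolding normal_density_def \<sigma>(2) using assms by (simp add: real_sqrt_divide field_simps)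
  have "has_bochner_integral lborel (\<lambda>x. 1 / sqrt a * normal_density 0 \<sigma> x) (1 / sqrt a * 1)"
    using \<sigma>(1) by (intro has_bochner_integral_mult_right) (simp add: has_bochner_integral_iff)
  then show ?thesis unfolding eq by simp
qed

text \<open>Squaring the majorant gives two copies of the Gaussian: off the interval one is at most
  \<open>exp (- pi * a * T\<^sup>2)\<close>, and the other is integrated over the whole line. Used
  both in time and in frequency.\<close>

lemma gaussian_tail_energy:
  fixes f :: "real \<Rightarrow> complex"
  assumes a: "0 < a" and T: "0 \<le> T"
    and dom: "AE x in lborel. cmod (f x) \<le> C * exp (- pi * a * \<bar>x\<bar>\<^sup>2)"
  shows "(\<integral>\<^sup>+ x. indicator (- {-T..T}) x * ennreal ((cmod (f x))\<^sup>2) \<partial>lborel)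
    \<le> ennreal (C\<^sup>2 * exp (- pi * a * T\<^sup>2) / sqrt a)"
proof -
  let ?G = "\<lambda>x. C\<^sup>2 * exp (- pi * a * T\<^sup>2) * exp (- pi * a * x\<^sup>2)"
  have "(\<integral>\<^sup>+ x. indicator (- {-T..T}) x * ennreal ((cmod (f x))\<^sup>2) \<partial>lborel)
    \<le> (\<integral>\<^sup>+ x. ennreal (?G x) \<partial>lborel)"
  proof (rule nn_integral_mono_AE, use dom in eventually_elim)
    fix x assume fx: "cmod (f x) \<le> C * exp (- pi * a * \<bar>x\<bar>\<^sup>2)"
    show "indicator (- {-T..T}) x * ennreal ((cmod (f x))\<^sup>2) \<le> ennreal (?G x)"
    proof (cases "x \<in> {-T..T}")
      case False
      then have "T \<le> \<bar>x\<bar>" by auto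
      then have "T\<^sup>2 \<le> x\<^sup>2" using T by (metis power2_abs power_mono)
      then have T2: "pi * a * T\<^sup>2 \<le> pi * a * x\<^sup>2" using a by (intro mult_left_mono) auto
      have "(cmod (f x))\<^sup>2 \<le> (C * exp (- pi * a * \<bar>x\<bar>\<^sup>2))\<^sup>2"
        using fx by (intro power_mono) auto
      also have "\<dots> = C\<^sup>2 * exp (- pi * a * x\<^sup>2) * exp (- pi * a * x\<^sup>2)"
        by (simp add: power_mult_distrib power2_eq_square)
      also have "\<dots> \<le> ?G x"
        using T2 by (intro mult_right_mono mult_left_mono) auto
      finally show ?thesis using False by (auto intro: ennreal_leI)
    qed simp
  qed
  also have "\<dots> = ennreal (C\<^sup>2 * exp (- pi * a * T\<^sup>2) * (1 / sqrt a))"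
    using has_bochner_integral_mult_right[OF gaussian_has_bochner_integral[OF a], of "C\<^sup>2 * exp (- pi * a * T\<^sup>2)"]
    by (subst nn_integral_eq_integral) (auto simp: has_bochner_integral_iff)
  finally show ?thesis by simp
qed

section \<open>Counting with the two cut-offs\<close>

definition truncate :: "real \<Rightarrow> (real \<Rightarrow> complex) \<Rightarrow> real \<Rightarrow> complex" where
  "truncate T f x = indicator {-T..T} x * f x"

lemma borel_measurable_truncate [measurable]:
  "f \<in> borel_measurable borel \<Longrightarrow> truncate T f \<in> borel_measurable borel"
  unfolding truncate_def by measurable

lemma integrable_truncate: "integrable lborel f \<Longrightarrow> integrable lborel (truncate T f)"
  unfolding truncate_def
  by (subst mult.commute, rule integrable_mult_bounded[where B=1]) (auto split: split_indicator)

lemma fourier_truncate_sum_le: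
  assumes I: "finite I" and e: "orthonormal_family I e" and T: "0 \<le> T"
  shows "(\<Sum>n\<in>I. (cmod (fourier (truncate T (e n)) \<xi>))\<^sup>2) \<le> 2 * T"
proof -
  \<comment> \<open>Pairing \<open>e n\<close> with this wave gives the transform of the truncated
    \<open>e n\<close> at \<open>\<xi>\<close>. Bessel's inequality has \<open>h\<close> in the
    first slot instead, which only conjugates the coefficient.\<close>
  define h where "h t = indicator {-T..T} t * cis (2 * pi * t * \<xi>)" for t
  have [measurable]: "h \<in> borel_measurable borel" unfolding h_def by measurable
  have h2: "(cmod (h t))\<^sup>2 = indicator {-T..T} t" for t
    by (auto simp: h_def norm_mult split: split_indicator)
  have h: "square_integrable h"
    unfolding square_integrable_def h2 by (auto intro!: integrable_real_indicator simp: emeasure_lborel_Icc_eq)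
  have "fourier (truncate T (e n)) \<xi> = L2_inner (e n) h" for n
    unfolding fourier_cis truncate_def L2_inner_def h_def
    by (intro Bochner_Integration.integral_cong) (auto simp: cis_cnj split: split_indicator)
  then have "cmod (fourier (truncate T (e n)) \<xi>) = cmod (L2_inner h (e n))" for n
    by (metis L2_inner_cnj complex_mod_cnj)
  then have "(\<Sum>n\<in>I. (cmod (fourier (truncate T (e n)) \<xi>))\<^sup>2) \<le> (LINT t|lborel. (cmod (h t))\<^sup>2)"
    using bessel_inequality[OF I e h] by simp
  also have "\<dots> = 2 * T" unfolding h2 using T by simp
  finally show ?thesis .
qed

text \<open>The squared norm of \<open>Q \<F> P f\<close> in the notation of the opening
  comment.\<close>

definition truncated_energy :: "real \<Rightarrow> (real \<Rightarrow> complex) \<Rightarrow> ennreal" where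
  "truncated_energy T f =
    (\<integral>\<^sup>+ \<xi>. indicator {-T..T} \<xi> * ennreal ((cmod (fourier (truncate T f) \<xi>))\<^sup>2) \<partial>lborel)"

text \<open>The pointwise bound \<open>2 * T\<close> is integrated over a frequency interval of
  length \<open>2 * T\<close>. In effect this is the trace of the time- and band-limiting
  operator.\<close>

lemma truncated_energy_sum_le:
  assumes I: "finite I" and e: "orthonormal_family I e" and T: "0 \<le> T"
  shows "(\<Sum>n\<in>I. truncated_energy T (e n)) \<le> ennreal (4 * T\<^sup>2)"
proof -
  have [measurable]: "e n \<in> borel_measurable borel" if "n \<in> I" for n
    using e that by (auto simp: orthonormal_family_def square_integrable_def)
  have "(\<Sum>n\<in>I. truncated_energy T (e n))
    = (\<integral>\<^sup>+ \<xi>. (\<Sum>n\<in>I. indicator {-T..T} \<xi> * ennreal ((cmod (fourier (truncate T (e n)) \<xi>))\<^sup>2)) \<partial>lborel)"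
    unfolding truncated_energy_def by (rule nn_integral_sum[symmetric]) measurable
  also have "\<dots> \<le> (\<integral>\<^sup>+ \<xi>. ennreal (2 * T) * indicator {-T..T} \<xi> \<partial>lborel)"
    using fourier_truncate_sum_le[OF I e T]
    by (intro nn_integral_mono)
       (auto simp: sum_distrib_left[symmetric] sum_ennreal ennreal_leI split: split_indicator)
  also have "\<dots> = ennreal (4 * T\<^sup>2)"
    using T by (simp add: nn_integral_cmult_indicator power2_eq_square flip: ennreal_mult)
  finally show ?thesis .
qed

text \<open>Plancherel passes the unit norm to \<open>fourier f\<close>. Frequencies outside the
  interval cost one Gaussian tail. Replacing \<open>f\<close> by its truncation leaves
  \<open>r\<close>, whose energy is another tail and enters with coefficient 4; hence the 5.\<close>

lemma one_le_truncated_energy: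
  fixes f fh :: "real \<Rightarrow> complex"
  assumes a: "0 < a" and C: "0 < C" and T: "0 \<le> T"
    and ffh: "has_L2_fourier f fh" and unit: "L2_inner f f = 1"
    and f_dom: "AE x in lborel. cmod (f x) \<le> C * exp (- pi * a * \<bar>x\<bar>\<^sup>2)"
    and fh_dom: "AE x in lborel. cmod (fh x) \<le> C * exp (- pi * a * \<bar>x\<bar>\<^sup>2)"
  shows "1 \<le> ennreal (4 / 3) * truncated_energy T f
    + ennreal (5 * (C\<^sup>2 * exp (- pi * a * T\<^sup>2) / sqrt a))"
proof -
  define \<delta> where "\<delta> = C\<^sup>2 * exp (- pi * a * T\<^sup>2) / sqrt a"
  have \<delta>: "0 \<le> \<delta>" using a by (simp add: \<delta>_def)
  have fsq: "square_integrable f" using ffh by (simp add: has_L2_fourier_def)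
  then have [measurable]: "f \<in> borel_measurable borel" by (simp add: square_integrable_def)
  let ?g = "\<lambda>x. C * exp (- pi * a * x\<^sup>2)"
  have g_int: "integrable lborel ?g"
    using gaussian_has_bochner_integral[OF a] by (auto simp: has_bochner_integral_iff)
  have f_int: "integrable lborel f"
    by (rule Bochner_Integration.integrable_bound[OF g_int]) (use f_dom C in auto)
  define r where "r x = f x - truncate T f x" for x
  have r_int: "integrable lborel r"
    unfolding r_def using f_int integrable_truncate[OF f_int] by simp
  have [measurable]: "r \<in> borel_measurable borel" using r_int by simp
  have r_energy: "energy (fourier r) \<le> ennreal \<delta>"
  proof -
    have "energy r = (\<integral>\<^sup>+ x. indicator (- {-T..T}) x * ennreal ((cmod (f x))\<^sup>2) \<partial>lborel)"
      unfolding energy_def r_def truncate_def by (intro nn_integral_cong) (auto split: split_indicator)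
    also have "\<dots> \<le> ennreal \<delta>"
      unfolding \<delta>_def by (rule gaussian_tail_energy[OF a T f_dom])
    finally show ?thesis using energy_fourier_le[OF r_int] by (rule order.trans[rotated])
  qed
  have tail: "(\<integral>\<^sup>+ \<xi>. indicator (- {-T..T}) \<xi> * ennreal ((cmod (fourier f \<xi>))\<^sup>2) \<partial>lborel) \<le> ennreal \<delta>"
  proof -
    have "AE \<xi> in lborel. cmod (fourier f \<xi>) \<le> C * exp (- pi * a * \<bar>\<xi>\<bar>\<^sup>2)"
      using has_L2_fourier_AE_eq[OF f_int ffh] fh_dom by eventually_elim simp
    then show ?thesis unfolding \<delta>_def by (rule gaussian_tail_energy[OF a T])
  qed
  have "1 = energy f"
  proof -
    have "energy f = ennreal (LINT x|lborel. (cmod (f x))\<^sup>2)"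
      unfolding energy_def using fsq by (intro nn_integral_eq_integral) (auto simp: square_integrable_def)
    also have "(LINT x|lborel. (cmod (f x))\<^sup>2) = 1"
      using unit unfolding L2_inner_self by (simp only: of_real_eq_1_iff)
    finally show ?thesis by simp
  qed
  also have "energy f \<le> energy (fourier f)"
  proof (rule energy_le_energy_fourier[of f ?g C])
    show "continuous_on UNIV ?g" by (intro continuous_intros)
    show "0 < ?g x" for x using C by simp
    show "?g x \<le> C" for x using C a by simp
  qed (use g_int f_dom in auto)
  also have "\<dots> \<le> (\<integral>\<^sup>+ \<xi>. ennreal (4 / 3) * (indicator {-T..T} \<xi> * ennreal ((cmod (fourier (truncate T f) \<xi>))\<^sup>2))
      + ennreal 4 * ennreal ((cmod (fourier r \<xi>))\<^sup>2)
      + indicator (- {-T..T}) \<xi> * ennreal ((cmod (fourier f \<xi>))\<^sup>2) \<partial>lborel)"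
    unfolding energy_def
  proof (rule nn_integral_mono)
    fix \<xi>
    have "fourier f \<xi> = fourier (truncate T f) \<xi> + fourier r \<xi>"
      unfolding r_def by (simp add: fourier_diff[OF f_int integrable_truncate[OF f_int]])
    \<comment> \<open>Taking \<open>\<eta> = 1 / 3\<close> gives the coefficients 4/3 and 4. Against
      the total \<open>4 * T\<^sup>2\<close> the first yields \<open>16 / 3 * T\<^sup>2\<close>,
      which leaves room below \<open>8 * T\<^sup>2\<close>.\<close>
    then have "(cmod (fourier f \<xi>))\<^sup>2
      \<le> 4 / 3 * (cmod (fourier (truncate T f) \<xi>))\<^sup>2 + 4 * (cmod (fourier r \<xi>))\<^sup>2"
      using norm_add_square_le[of "1 / 3" "fourier (truncate T f) \<xi>" "fourier r \<xi>"] by simp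
    then have "ennreal ((cmod (fourier f \<xi>))\<^sup>2)
      \<le> ennreal (4 / 3 * (cmod (fourier (truncate T f) \<xi>))\<^sup>2 + 4 * (cmod (fourier r \<xi>))\<^sup>2)"
      by (rule ennreal_leI)
    also have "\<dots> = ennreal (4 / 3) * ennreal ((cmod (fourier (truncate T f) \<xi>))\<^sup>2)
        + ennreal 4 * ennreal ((cmod (fourier r \<xi>))\<^sup>2)"
      by (subst ennreal_plus, simp, simp) (simp only: ennreal_mult zero_le_power2 divide_nonneg_pos zero_le_numeral zero_less_numeral)
    finally have "ennreal ((cmod (fourier f \<xi>))\<^sup>2)
      \<le> ennreal (4 / 3) * ennreal ((cmod (fourier (truncate T f) \<xi>))\<^sup>2) + ennreal 4 * ennreal ((cmod (fourier r \<xi>))\<^sup>2)" .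
    then show "ennreal ((cmod (fourier f \<xi>))\<^sup>2)
      \<le> ennreal (4 / 3) * (indicator {-T..T} \<xi> * ennreal ((cmod (fourier (truncate T f) \<xi>))\<^sup>2))
      + ennreal 4 * ennreal ((cmod (fourier r \<xi>))\<^sup>2)
      + indicator (- {-T..T}) \<xi> * ennreal ((cmod (fourier f \<xi>))\<^sup>2)"
      by (cases "\<xi> \<in> {-T..T}") auto
  qed
  also have "\<dots> = ennreal (4 / 3) * truncated_energy T f + ennreal 4 * energy (fourier r)
      + (\<integral>\<^sup>+ \<xi>. indicator (- {-T..T}) \<xi> * ennreal ((cmod (fourier f \<xi>))\<^sup>2) \<partial>lborel)"
    unfolding truncated_energy_def energy_def by (simp add: nn_integral_add nn_integral_cmult)
  also have "\<dots> \<le> ennreal (4 / 3) * truncated_energy T f + ennreal 4 * ennreal \<delta> + ennreal \<delta>"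
    using r_energy tail by (intro add_mono mult_left_mono order.refl) auto
  also have "\<dots> = ennreal (4 / 3) * truncated_energy T f + ennreal (5 * \<delta>)"
  proof -
    have "ennreal 4 * ennreal \<delta> + ennreal \<delta> = ennreal (4 * \<delta> + \<delta>)"
      using \<delta> by (simp only: ennreal_mult ennreal_plus mult_nonneg_nonneg zero_le_numeral)
    then show ?thesis by (simp add: add.assoc)
  qed
  finally show ?thesis by (simp add: \<delta>_def)
qed

text \<open>The unit lower bounds are summed over \<open>I\<close> and compared with the total
  truncated energy. The radius \<open>T\<close> stays free, to be chosen large enough to make the
  tail error small.\<close>

lemma card_orthonormal_gaussian_le:
  fixes e eh :: "'i \<Rightarrow> real \<Rightarrow> complex"
  assumes a: "0 < a" and C: "0 < C" and T: "0 \<le> T" and I: "finite I"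
    and e: "orthonormal_family I e"
    and eh: "\<And>n. n \<in> I \<Longrightarrow> has_L2_fourier (e n) (eh n)"
    and e_dom: "\<And>n. n \<in> I \<Longrightarrow> AE x in lborel. cmod (e n x) \<le> C * exp (- pi * a * \<bar>x\<bar>\<^sup>2)"
    and eh_dom: "\<And>n. n \<in> I \<Longrightarrow> AE x in lborel. cmod (eh n x) \<le> C * exp (- pi * a * \<bar>x\<bar>\<^sup>2)"
  shows "real (card I) * (1 - 5 * (C\<^sup>2 * exp (- pi * a * T\<^sup>2) / sqrt a)) \<le> 16 / 3 * T\<^sup>2"
proof -
  define \<delta> where "\<delta> = C\<^sup>2 * exp (- pi * a * T\<^sup>2) / sqrt a"
  have \<delta>: "0 \<le> \<delta>" using a by (simp add: \<delta>_def)
  have "ennreal (real (card I)) = (\<Sum>n\<in>I. 1)" by (simp add: ennreal_of_nat_eq_real_of_nat)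
  also have "\<dots> \<le> (\<Sum>n\<in>I. ennreal (4 / 3) * truncated_energy T (e n) + ennreal (5 * \<delta>))"
    unfolding \<delta>_def using e
    by (intro sum_mono one_le_truncated_energy[OF a C T eh _ e_dom eh_dom])
       (auto simp: orthonormal_family_def)
  also have "\<dots> = ennreal (4 / 3) * (\<Sum>n\<in>I. truncated_energy T (e n)) + ennreal (real (card I) * (5 * \<delta>))"
    using \<delta> by (simp add: sum.distrib sum_distrib_left ennreal_of_nat_eq_real_of_nat ennreal_mult)
  also have "\<dots> \<le> ennreal (4 / 3) * ennreal (4 * T\<^sup>2) + ennreal (real (card I) * (5 * \<delta>))"
    by (intro add_right_mono mult_left_mono truncated_energy_sum_le[OF I e T]) auto
  also have "\<dots> = ennreal (16 / 3 * T\<^sup>2 + real (card I) * (5 * \<delta>))"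
    using \<delta> by (subst ennreal_mult[symmetric], simp, simp) (subst ennreal_plus[symmetric], auto)
  finally have "real (card I) \<le> 16 / 3 * T\<^sup>2 + real (card I) * (5 * \<delta>)"
    using \<delta> by (subst (asm) ennreal_le_iff) auto
  then show ?thesis unfolding \<delta>_def[symmetric] by (simp add: algebra_simps)
qed

section \<open>Choice of the cut-off radius and the final count\<close>

theorem proposition3p10:
  fixes a C :: real and N :: nat and e eh :: "nat \<Rightarrow> real \<Rightarrow> complex"
  assumes "0 < a" and "a \<le> 1" and "C \<ge> (2 * a) powr (1 / 4)"
    and "orthonormal_family {0..N} e"
    and "\<And>n. n \<in> {0..N} \<Longrightarrow> has_L2_fourier (e n) (eh n)"
    and "\<And>n. n \<in> {0..N} \<Longrightarrow> AE x in lborel. cmod (e n x) \<le> C * exp (- pi * a * \<bar>x\<bar>\<^sup>2)"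
    and "\<And>n. n \<in> {0..N} \<Longrightarrow> AE \<xi> in lborel. cmod (eh n \<xi>) \<le> C * exp (- pi * a * \<bar>\<xi>\<bar>\<^sup>2)"
  shows "real N \<le> 2 + 8 / (a * pi) *
           max (2 * ln (50 * C * sqrt pi * exp pi / a powr (1 / 4)))
               (ln (50 * pi * C\<^sup>2 * exp (pi * a / 2) / (a powr (5 / 2) * exp (2 * pi))))"
proof -
  define A where "A = 50 * C * sqrt pi * exp pi / a powr (1 / 4)"
  define L where "L = 2 * ln A"
  \<comment> \<open>\<open>L\<close> is the first argument of the maximum, and this radius makes
    \<open>pi * a * T\<^sup>2 = L\<close>.\<close>
  define T where "T = sqrt (L / (a * pi))"
  have a4: "0 < a powr (1 / 4)" using assms(1) by simp
  \<comment> \<open>Follows from \<open>a \<le> 2 * a\<close> and the lower bound on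
    \<open>C\<close>. It forces \<open>A \<ge> 1\<close>, hence \<open>L \<ge> 0\<close>, so that
    \<open>T\<close> is a genuine square root.\<close>
  have Ca: "a powr (1 / 4) \<le> C"
    using assms(1,3) powr_mono2[of "1/4" a "2 * a"] by simp
  then have C: "0 < C" using a4 by linarith
  have sq: "1 \<le> sqrt pi" using pi_gt3 by simp
  define q where "q = C / a powr (1 / 4)"
  have q: "1 \<le> q" using Ca a4 by (simp add: q_def)
  have "1 * 1 * 1 \<le> q * sqrt pi * exp pi"
    using q sq by (intro mult_mono) auto
  then have A1: "1 \<le> A" by (simp add: A_def q_def)
  have L0: "0 \<le> L" using A1 by (simp add: L_def)
  then have T2: "T\<^sup>2 = L / (a * pi)" using assms(1) by (simp add: T_def)
  have T0: "0 \<le> T" using L0 assms(1) by (simp add: T_def)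
  have "exp L = A\<^sup>2" using A1 by (simp add: L_def exp_double)
  also have "\<dots> = 2500 * C\<^sup>2 * pi * exp (2 * pi) / sqrt a"
  proof -
    have "(a powr (1 / 4))\<^sup>2 = sqrt a"
      using assms(1) by (simp add: power2_eq_square powr_half_sqrt flip: powr_add)
    then show ?thesis
      by (simp add: A_def power_mult_distrib power_divide exp_double)
  qed
  finally have expL: "exp L = 2500 * C\<^sup>2 * pi * exp (2 * pi) / sqrt a" .
  \<comment> \<open>Since \<open>pi * exp (2 * pi)\<close> is at least 1, \<open>exp L\<close>
    dominates \<open>2500 * (C\<^sup>2 / sqrt a)\<close>, where 2500 is the square of 50.
    Multiplying by \<open>exp (- L)\<close> bounds the tail error by 1/2500.\<close>
  have "2500 * (C\<^sup>2 / sqrt a) * (1 * 1) \<le> 2500 * (C\<^sup>2 / sqrt a) * (pi * exp (2 * pi))"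
    using assms(1) pi_gt3 by (intro mult_left_mono mult_mono) auto
  also have "\<dots> = exp L" by (simp add: expL)
  finally have "2500 * (C\<^sup>2 / sqrt a) * exp (- L) \<le> exp L * exp (- L)"
    by (intro mult_right_mono) simp_all
  then have "C\<^sup>2 / sqrt a * exp (- L) \<le> 1 / 2500"
    by (simp add: mult_ac flip: exp_add)
  moreover have "- pi * a * T\<^sup>2 = - L" using assms(1) by (simp add: T2)
  ultimately have \<delta>: "C\<^sup>2 * exp (- pi * a * T\<^sup>2) / sqrt a \<le> 1 / 2500"
    by (simp only: times_divide_eq_left)
  \<comment> \<open>The index set \<open>{0..N}\<close> has \<open>N + 1\<close> elements. The
    factor is 499/500, and 16/3 divided by it is still below 8.\<close>
  have "real (N + 1) * (1 - 5 * (1 / 2500))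
    \<le> real (N + 1) * (1 - 5 * (C\<^sup>2 * exp (- pi * a * T\<^sup>2) / sqrt a))"
    by (intro mult_left_mono diff_left_mono \<delta> of_nat_0_le_iff) simp
  also have "\<dots> \<le> 16 / 3 * T\<^sup>2"
    using card_orthonormal_gaussian_le[OF assms(1) C T0 _ assms(4-7)] by simp
  finally have "real N \<le> 8 * T\<^sup>2" by simp
  also have "\<dots> = 8 / (a * pi) * L" by (simp add: T2)
  \<comment> \<open>\<open>L\<close> is at most the maximum, and the summand 2 is
    nonnegative.\<close>
  also have "\<dots> \<le> 2 + 8 / (a * pi) * max L (ln (50 * pi * C\<^sup>2 * exp (pi * a / 2) / (a powr (5 / 2) * exp (2 * pi))))"
    using assms(1) by (intro add_increasing mult_left_mono) auto
  finally show ?thesis by (simp add: L_def A_def)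
qed

end
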